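(* Let $\mathcal{G}$ be a connected metric graph with vertex set $\mathsf{V}$ and let $\alpha\in\mathbb{R}^{\mathsf{V}}$ be such that the torsion function of $(\mathcal{G},\alpha)$ exists. Fix $\mathsf{v}_0\in\mathsf{V}$ and, for $s\in\mathbb{R}$, let $\alpha_s\in\mathbb{R}^{\mathsf{V}}$ be given by $\alpha_{s,\mathsf{v}_0}=s$ and $\alpha_{s,\mathsf{v}}=\alpha_{\mathsf{v}}$ for $\mathsf{v}\neq\mathsf{v}_0$. Denote by $\upsilon_s$ the torsion function of $(\mathcal{G},\alpha_s)$. Then there exists a neighborhood $U\subset\mathbb{R}$ of $\alpha_{\mathsf{v}_0}$ such that the map $U\ni s\mapsto T(\mathcal{G},\alpha_s)$ is (well defined and) continuously differentiable, and its derivative at $s=\alpha_{\mathsf{v}_0}$ is $$\frac{d}{ds}\bigg|_{s=\alpha_{\mathsf{v}_0}}T(\mathcal{G},\alpha_s)=-\upsilon_s(\mathsf{v}_0)^2,$$ where the right-hand side is evaluated at $s=\alpha_{\mathsf{v}_0}$. Furthermore, if $\alpha\in[0,\infty)^{\mathsf{V}}$ and $\alpha_{\mathsf{v}_0}>0$, then $U$ can be chosen as $(0,\infty)$.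
   Context: A metric graph $\mathcal{G}$ is a finite collection of intervals glued together at their endpoints according to a finite combinatorial graph $(\mathsf{V},\mathsf{E})$ (loops and multiple edges allowed); each edge $\mathsf{e}\in\mathsf{E}$ is identified with $[0,\ell_{\mathsf{e}}]$, $\ell_{\mathsf{e}}\in(0,\infty)$. It is connected if any two points are joined by a continuous path. $\mathsf{E}_{\mathsf{v}}$ is the collection of edges incident to $\mathsf{v}$ (a loop at $\mathsf{v}$ counted twice, once for each endpoint), $u_{\mathsf{e}}$ is the restriction of $u$ to $\mathsf{e}$, and $\frac{\partial u_{\mathsf{e}}}{\partial n}(\mathsf{v})$ is the derivative of $u_{\mathsf{e}}$ at the endpoint $\mathsf{v}$ in the direction pointing into $\mathsf{v}$. For $\alpha\in\mathbb{R}^{\mathsf{V}}$, the operator $-\Delta_{\mathcal{G},\alpha}$ in $L^2(\mathcal{G})$ acts as $u\mapsto -u''$ on each edge, on functions that are edgewise in $H^2(0,\ell_{\mathsf{e}})$, continuous at every vertex, and satisfy $\sum_{\mathsf{e}\in\mathsf{E}_{\mathsf{v}}}\frac{\partial u_{\mathsf{e}}}{\partial n}(\mathsf{v})+\alpha_{\mathsf{v}}u(\mathsf{v})=0$ for all $\mathsf{v}\in\mathsf{V}$. The torsion function of $(\mathcal{G},\alpha)$ is the unique solution $\upsilon$ of $-\Delta_{\mathcal{G},\alpha}\upsilon=1$; it "exists" if this equation has a unique solution (no sign condition on $\upsilon$ is required). The torsional rigidity is $T(\mathcal{G},\alpha)=\int_{\mathcal{G}}\upsilon(x)\,\mathrm{d}x$.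 *)

theory Defs
  imports "HOL-Analysis.Analysis" "Graph_Theory.Digraph"
begin

section \<open>Metric graphs\<close>

text \<open>
  The directed multigraphs of \<open>Graph_Theory\<close> allow loops and parallel arcs. The orientation of an
  arc \<open>e\<close> only serves to identify it with the interval \<open>[0, len G e]\<close>: \<open>0\<close> is glued to \<open>tail G e\<close>
  and \<open>len G e\<close> to \<open>head G e\<close>.
\<close>

record ('v, 'e) mgraph = "('v, 'e) pre_digraph" +
  len :: "'e \<Rightarrow> real"

locale metric_graph =
  fixes G :: "('v, 'e) mgraph" (structure)
  assumes fin_digraph: "fin_digraph (pre_digraph.truncate G)"
    and len_pos: "e \<in> arcs G \<Longrightarrow> 0 < len G e"

datatype ('v, 'e) mg_point = Vertex 'v | Interior 'e real

definition points :: "('v, 'e) mgraph \<Rightarrow> ('v, 'e) mg_point set" where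
  "points G = Vertex ` verts G \<union> {Interior e x |e x. e \<in> arcs G \<and> 0 < x \<and> x < len G e}"

definition glue :: "('v, 'e) mgraph \<Rightarrow> 'e \<Rightarrow> real \<Rightarrow> ('v, 'e) mg_point" where
  "glue G e x =
     (if x = 0 then Vertex (tail G e)
      else if x = len G e then Vertex (head G e)
      else Interior e x)"

text \<open>
  The quotient topology: the finest one for which all the maps \<open>glue G e\<close> from \<open>[0, len G e]\<close>
  are continuous.
\<close>

definition mg_topology :: "('v, 'e) mgraph \<Rightarrow> ('v, 'e) mg_point topology" where
  "mg_topology G = topology (\<lambda>U. U \<subseteq> points G \<and>
     (\<forall>e\<in>arcs G. openin (top_of_set {0..len G e}) {x \<in> {0..len G e}. glue G e x \<in> U}))"

lemma openin_mg_topology: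
  "openin (mg_topology G) U \<longleftrightarrow> U \<subseteq> points G \<and>
     (\<forall>e\<in>arcs G. openin (top_of_set {0..len G e}) {x \<in> {0..len G e}. glue G e x \<in> U})"
proof -
  let ?L = "\<lambda>U. U \<subseteq> points G \<and>
     (\<forall>e\<in>arcs G. openin (top_of_set {0..len G e}) {x \<in> {0..len G e}. glue G e x \<in> U})"
  have "istopology ?L"
    unfolding istopology_def
  proof (intro conjI allI impI)
    fix S T assume S: "?L S" and T: "?L T"
    have "{x \<in> {0..len G e}. glue G e x \<in> S \<inter> T} =
        {x \<in> {0..len G e}. glue G e x \<in> S} \<inter> {x \<in> {0..len G e}. glue G e x \<in> T}" for e
      by auto
    with S T show "S \<inter> T \<subseteq> points G"
      and "\<forall>e\<in>arcs G. openin (top_of_set {0..len G e}) {x \<in> {0..len G e}. glue G e x \<in> S \<inter> T}"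
      by (auto simp only: intro!: openin_Int)
  next
    fix \<K> assume K: "\<forall>K\<in>\<K>. ?L K"
    have "{x \<in> {0..len G e}. glue G e x \<in> \<Union>\<K>} =
        (\<Union>K\<in>\<K>. {x \<in> {0..len G e}. glue G e x \<in> K})" for e
      by auto
    with K show "\<Union>\<K> \<subseteq> points G"
      and "\<forall>e\<in>arcs G. openin (top_of_set {0..len G e}) {x \<in> {0..len G e}. glue G e x \<in> \<Union>\<K>}"
      by (auto simp only: intro!: openin_Union)
  qed
  then show ?thesis
    unfolding mg_topology_def by (simp add: topology_inverse')
qed

definition connected_mg :: "('v, 'e) mgraph \<Rightarrow> bool" where
  "connected_mg G \<longleftrightarrow> path_connected_space (mg_topology G)"

definition on_edge :: "('v, 'e) mgraph \<Rightarrow> (('v, 'e) mg_point \<Rightarrow> real) \<Rightarrow> 'e \<Rightarrow> real \<Rightarrow> real" where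
  "on_edge G u e = (\<lambda>x. u (glue G e x))"

definition mg_integral :: "('v, 'e) mgraph \<Rightarrow> (('v, 'e) mg_point \<Rightarrow> real) \<Rightarrow> real" where
  "mg_integral G u = (\<Sum>e\<in>arcs G. LINT x|lebesgue_on {0..len G e}. on_edge G u e x)"


section \<open>Sobolev spaces on a bounded interval\<close>

definition L2 :: "real \<Rightarrow> (real \<Rightarrow> real) set" where
  "L2 l = {f \<in> borel_measurable (lebesgue_on {0<..<l}).
             integrable (lebesgue_on {0<..<l}) (\<lambda>x. (f x)\<^sup>2)}"

text \<open>
  As in Brezis' textbook on Sobolev spaces, the test functions are the compactly supported
  \<open>C\<^sup>1\<close> functions and \<open>H\<^sup>k\<close> is defined by iterating first weak derivatives.
\<close>

definition test_function :: "real \<Rightarrow> (real \<Rightarrow> real) \<Rightarrow> bool" where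
  "test_function l \<phi> \<longleftrightarrow> \<phi> C1_differentiable_on UNIV \<and> closure {x. \<phi> x \<noteq> 0} \<subseteq> {0<..<l}"

definition weak_deriv :: "real \<Rightarrow> (real \<Rightarrow> real) \<Rightarrow> (real \<Rightarrow> real) \<Rightarrow> bool" where
  "weak_deriv l f g \<longleftrightarrow> (\<forall>\<phi>. test_function l \<phi> \<longrightarrow>
     (LINT x|lebesgue_on {0<..<l}. f x * deriv \<phi> x) = - (LINT x|lebesgue_on {0<..<l}. g x * \<phi> x))"

primrec sobolev :: "nat \<Rightarrow> real \<Rightarrow> (real \<Rightarrow> real) set" where
  "sobolev 0 l = L2 l"
| "sobolev (Suc k) l = {f \<in> L2 l. \<exists>g \<in> sobolev k l. weak_deriv l f g}"


section \<open>The Laplacian with vertex strengths \<open>\<alpha>\<close>, torsion function and torsional rigidity\<close>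

text \<open>
  The sum over all edge ends at \<open>v\<close> of the derivatives pointing into \<open>v\<close>; a loop contributes to
  both sums. The function \<open>on_edge G u e\<close> is only meaningful on \<open>[0, len G e]\<close>, so its derivatives
  at the end points are one-sided.
\<close>

definition flux :: "('v, 'e) mgraph \<Rightarrow> (('v, 'e) mg_point \<Rightarrow> real) \<Rightarrow> 'v \<Rightarrow> real" where
  "flux G u v =
     (\<Sum>e | e \<in> arcs G \<and> tail G e = v.
        - vector_derivative (on_edge G u e) (at 0 within {0..len G e})) +
     (\<Sum>e | e \<in> arcs G \<and> head G e = v.
        vector_derivative (on_edge G u e) (at (len G e) within {0..len G e}))"

text \<open>
  Elements of the operator domain are represented by their continuous representatives, extended
  by \<open>0\<close> outside \<open>points G\<close>, so that they are determined as HOL functions. Continuity at the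
  vertices is continuity of all \<open>on_edge G u e\<close> up to the end points, where they take the common
  value \<open>u (Vertex v)\<close>.
\<close>

definition lap_domain :: "('v, 'e) mgraph \<Rightarrow> ('v \<Rightarrow> real) \<Rightarrow> (('v, 'e) mg_point \<Rightarrow> real) set" where
  "lap_domain G \<alpha> = {u.
     (\<forall>p. p \<notin> points G \<longrightarrow> u p = 0) \<and>
     (\<forall>e\<in>arcs G. on_edge G u e \<in> sobolev 2 (len G e) \<and>
                  continuous_on {0..len G e} (on_edge G u e)) \<and>
     (\<forall>v\<in>verts G. flux G u v + \<alpha> v * u (Vertex v) = 0)}"

definition neg_laplacian :: "('v, 'e) mgraph \<Rightarrow> ('v \<Rightarrow> real) \<Rightarrow>
    (('v, 'e) mg_point \<Rightarrow> real) \<Rightarrow> (('v, 'e) mg_point \<Rightarrow> real) \<Rightarrow> bool" where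
  "neg_laplacian G \<alpha> u f \<longleftrightarrow> u \<in> lap_domain G \<alpha> \<and>
     (\<forall>e\<in>arcs G. on_edge G f e \<in> L2 (len G e) \<and>
        (\<exists>g \<in> L2 (len G e). weak_deriv (len G e) (on_edge G u e) g \<and>
                            weak_deriv (len G e) g (\<lambda>x. - on_edge G f e x)))"

definition torsion_exists :: "('v, 'e) mgraph \<Rightarrow> ('v \<Rightarrow> real) \<Rightarrow> bool" where
  "torsion_exists G \<alpha> \<longleftrightarrow> (\<exists>!u. neg_laplacian G \<alpha> u (\<lambda>_. 1))"

definition torsion :: "('v, 'e) mgraph \<Rightarrow> ('v \<Rightarrow> real) \<Rightarrow> ('v, 'e) mg_point \<Rightarrow> real" where
  "torsion G \<alpha> = (THE u. neg_laplacian G \<alpha> u (\<lambda>_. 1))"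

definition rigidity :: "('v, 'e) mgraph \<Rightarrow> ('v \<Rightarrow> real) \<Rightarrow> real" where
  "rigidity G \<alpha> = mg_integral G (torsion G \<alpha>)"

end

theory Submission
  imports Defs
begin

text \<open>
  By the lemma of du Bois-Reymond, a weak solution of \<open>- u'' = 1\<close> is on each edge the quadratic
  polynomial with second derivative \<open>- 1\<close> that interpolates the values at the two end points.
  Hence \<open>u\<close> is the torsion function iff its vertex values solve \<open>(L + diag \<alpha>) f = d\<close>, where \<open>L\<close> is
  the Laplace matrix of the graph with weights \<open>1 / len\<close> and \<open>d v\<close> is half the total length of the
  edge ends at \<open>v\<close>; the rigidity is \<open>\<Sum> f v * d v\<close> plus a constant. Moving \<open>\<alpha> v\<^sub>0\<close> by \<open>t\<close> is a rank-one
  perturbation: if \<open>(L + diag \<alpha>) w\<close> is the indicator of \<open>v\<^sub>0\<close>, the rigidity changes by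
  \<open>- t * (f v\<^sub>0)\<^sup>2 / (1 + t * w v\<^sub>0)\<close>, by the symmetry of \<open>L\<close>. For nonnegative \<open>\<alpha>\<close> and a positive
  strength at \<open>v\<^sub>0\<close>, a zero of the denominator would make \<open>w\<close> a null vector of a
  positive semidefinite matrix, forcing \<open>w v\<^sub>0 = 0\<close>, which is absurd.
\<close>

section \<open>Weak derivatives on an interval\<close>

lemma continuous_imp_integrable_Ioo:
  fixes f :: "real \<Rightarrow> real"
  assumes "continuous_on {a..b} f"
  shows "integrable (lebesgue_on {a<..<b}) f"
proof -
  have "integrable (lebesgue_on {a..b}) f"
    using assms by (rule continuous_imp_integrable_real)
  then have "set_integrable lebesgue {a..b} f"
    by (simp add: integrable_restrict_space set_integrable_def)
  then have "set_integrable lebesgue {a<..<b} f"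
    by (rule set_integrable_subset) auto
  then show ?thesis
    by (simp add: integrable_restrict_space set_integrable_def)
qed

lemma integral_Ioo_eq_integral:
  fixes f :: "real \<Rightarrow> real"
  assumes "continuous_on {a..b} f"
  shows "(LINT x|lebesgue_on {a<..<b}. f x) = integral {a..b} f"
  using lebesgue_integral_eq_integral[OF continuous_imp_integrable_Ioo[OF assms]]
  by (simp add: integral_open_interval_real)

lemma continuous_mem_L2:
  assumes "continuous_on {0..l} f"
  shows "f \<in> L2 l"
proof -
  have "integrable (lebesgue_on {0<..<l}) f" "integrable (lebesgue_on {0<..<l}) (\<lambda>x. (f x)\<^sup>2)"
    using assms by (auto intro!: continuous_imp_integrable_Ioo continuous_intros)
  then show ?thesis
    by (auto simp: L2_def)
qed

text \<open>A bounded interval has finite measure, so the pointwise bound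
  \<open>\<bar>y\<bar> \<le> 1 + y^2\<close> suffices.\<close>

lemma L2_integrable:
  assumes "f \<in> L2 l"
  shows "integrable (lebesgue_on {0<..<l}) f"
proof (rule Bochner_Integration.integrable_bound)
  show "integrable (lebesgue_on {0<..<l}) (\<lambda>x. 1 + (f x)\<^sup>2)"
    using assms continuous_imp_integrable_Ioo[of 0 l "\<lambda>_. 1"] by (auto simp: L2_def)
  have "\<bar>y\<bar> \<le> 1 + y\<^sup>2" for y :: real
    using sum_squares_ge_zero[of "\<bar>y\<bar> - 1" 0] by (simp add: algebra_simps power2_eq_square)
  then show "AE x in lebesgue_on {0<..<l}. norm (f x) \<le> norm (1 + (f x)\<^sup>2)"
    by (intro AE_I2) (smt (verit) real_norm_def)
qed (use assms in \<open>auto simp: L2_def\<close>)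

section \<open>The lemma of du Bois-Reymond\<close>

lemma bounded_continuous_on_UNIV_if_support:
  fixes \<psi> :: "real \<Rightarrow> real"
  assumes "continuous_on UNIV \<psi>" and "\<And>x. x \<notin> {a..b} \<Longrightarrow> \<psi> x = 0"
  obtains B where "\<And>x. \<bar>\<psi> x\<bar> \<le> B"
proof -
  have "compact (\<psi> ` {a..b})"
    using assms(1) by (intro compact_continuous_image) (auto intro: continuous_on_subset)
  then obtain B where B: "\<And>x. x \<in> {a..b} \<Longrightarrow> \<bar>\<psi> x\<bar> \<le> B"
    by (force dest!: compact_imp_bounded simp: bounded_iff)
  have "\<bar>\<psi> x\<bar> \<le> max B 0" for x
    using B[of x] assms(2)[of x] by (cases "x \<in> {a..b}") auto
  then show ?thesis
    by (rule that)
qed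

lemma integrable_mult_bounded:
  fixes k \<psi> :: "real \<Rightarrow> real"
  assumes k: "integrable M k" and "\<psi> \<in> borel_measurable M" and B: "\<And>x. \<bar>\<psi> x\<bar> \<le> B"
  shows "integrable M (\<lambda>x. k x * \<psi> x)"
proof (rule Bochner_Integration.integrable_bound)
  show "integrable M (\<lambda>x. B * k x)"
    using k by simp
  have "\<bar>k x * \<psi> x\<bar> \<le> \<bar>B * k x\<bar>" for x
    using mult_mono[OF B[of x] order_refl[of "\<bar>k x\<bar>"]] B[of x]
    by (simp add: abs_mult mult.commute)
  then show "AE x in M. norm (k x * \<psi> x) \<le> norm (B * k x)"
    by simp
qed (use assms in auto)

text \<open>Testing against compactly supported continuous approximations of
  \<open>sgn (k x)\<close> and passing to the limit shows that the integral of
  \<open>\<bar>k x\<bar>\<close> is zero.\<close>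

lemma AE_zero_if_orthogonal_to_compactly_supported:
  fixes k :: "real \<Rightarrow> real"
  assumes k: "integrable (lebesgue_on {0<..<l}) k"
    and orth: "\<And>\<psi> a b. \<lbrakk>continuous_on UNIV \<psi>; 0 < a; b < l; \<And>x. x \<notin> {a..b} \<Longrightarrow> \<psi> x = 0\<rbrakk>
      \<Longrightarrow> (LINT x|lebesgue_on {0<..<l}. k x * \<psi> x) = 0"
  shows "AE x in lebesgue_on {0<..<l}. k x = 0"
proof -
  let ?M = "lebesgue_on {0<..<l}"
  have [measurable]: "k \<in> borel_measurable ?M"
    using k by auto
  have "(\<lambda>x. sgn (k x)) \<in> borel_measurable ?M"
    by measurable
  then have "(\<lambda>x. sgn (k x)) measurable_on {0<..<l}"
    by (simp add: measurable_on_iff_borel_measurable)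
  then obtain N g where N: "negligible N" and g: "\<And>n. continuous_on UNIV (g n)"
    and lim: "\<And>x. x \<notin> N \<Longrightarrow> (\<lambda>n. g n x) \<longlonglongrightarrow> (if x \<in> {0<..<l} then sgn (k x) else 0)"
    unfolding measurable_on_def by metis
  \<comment> \<open>The cutoff vanishes within distance \<open>1 / (n + 1)\<close> of the end points
    and equals 1 from distance \<open>2 / (n + 1)\<close> on, so it tends to 1 at every interior
    point.\<close>
  define cut where "cut n x = min 1 (max 0 (real (Suc n) * min x (l - x) - 1))" for n x
  \<comment> \<open>Clamping to \<open>[-1, 1]\<close> makes \<open>\<bar>k x\<bar>\<close> a
    dominating function; it leaves the limit unchanged because signs lie in this range.\<close>
  define \<psi> where "\<psi> n x = max (-1) (min 1 (g n x)) * cut n x" for n x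
  have cont: "continuous_on UNIV (\<psi> n)" for n
    unfolding \<psi>_def cut_def by (intro continuous_intros g)
  have "0 \<le> cut n x" "cut n x \<le> 1" for n x
    unfolding cut_def by auto
  then have bound: "\<bar>\<psi> n x\<bar> \<le> 1" for n x
    unfolding \<psi>_def abs_mult by (intro mult_le_one) auto
  have supp: "\<psi> n x = 0" if "x \<notin> {1 / real (Suc n)..l - 1 / real (Suc n)}" for n x
  proof -
    have "min x (l - x) \<le> 1 / real (Suc n)"
      using that by auto
    then have "real (Suc n) * min x (l - x) \<le> 1"
      by (simp add: field_simps)
    then show ?thesis
      unfolding \<psi>_def cut_def by simp
  qed
  have zero: "(LINT x|?M. k x * \<psi> n x) = 0" for n
    by (rule orth[OF cont _ _ supp]) auto
  have cut_lim: "(\<lambda>n. cut n x) \<longlonglongrightarrow> 1" if "x \<in> {0<..<l}" for x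
  proof -
    have pos: "0 < min x (l - x)"
      using that by auto
    obtain n0 where "2 / min x (l - x) < real n0"
      using reals_Archimedean2 by blast
    then have n0: "2 < real n0 * min x (l - x)"
      using pos by (simp add: divide_less_eq)
    have "cut n x = 1" if "n0 \<le> n" for n
    proof -
      have "real n0 * min x (l - x) \<le> real (Suc n) * min x (l - x)"
        using that pos by (intro mult_right_mono) auto
      with n0 show ?thesis
        unfolding cut_def by auto
    qed
    then show ?thesis
      by (intro tendsto_eventually) (auto simp: eventually_sequentially)
  qed
  have conv: "(\<lambda>n. k x * \<psi> n x) \<longlonglongrightarrow> \<bar>k x\<bar>" if "x \<in> {0<..<l}" "x \<notin> N" for x
  proof -
    have "(\<lambda>n. g n x) \<longlonglongrightarrow> sgn (k x)"
      using lim[OF that(2)] that(1) by (simp del: greaterThanLessThan_iff)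
    then have "(\<lambda>n. k x * \<psi> n x) \<longlonglongrightarrow> k x * (max (-1) (min 1 (sgn (k x))) * 1)"
      unfolding \<psi>_def by (intro tendsto_intros cut_lim that(1))
    moreover have "k x * (max (-1) (min 1 (sgn (k x))) * 1) = \<bar>k x\<bar>"
      by (simp add: sgn_if)
    ultimately show ?thesis
      by metis
  qed
  have "(\<lambda>n. LINT x|?M. k x * \<psi> n x) \<longlonglongrightarrow> (LINT x|?M. \<bar>k x\<bar>)"
  proof (rule integral_dominated_convergence)
    show "integrable ?M (\<lambda>x. \<bar>k x\<bar>)"
      using k by simp
    have "\<psi> n \<in> borel_measurable ?M" for n
      using cont[of n] by (intro continuous_imp_measurable_on_sets_lebesgue) (auto intro: continuous_on_subset)
    then show "(\<lambda>x. k x * \<psi> n x) \<in> borel_measurable ?M" for n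
      by measurable
    show "AE x in ?M. norm (k x * \<psi> n x) \<le> \<bar>k x\<bar>" for n
      using bound by (intro AE_I2) (simp add: abs_mult mult_left_le)
    have "AE x in lebesgue. x \<notin> N"
      using N by (simp add: negligible_iff_null_sets AE_not_in)
    then have "AE x in lebesgue. x \<in> {0<..<l} \<longrightarrow> (\<lambda>n. k x * \<psi> n x) \<longlonglongrightarrow> \<bar>k x\<bar>"
      by eventually_elim (use conv in blast)
    then show "AE x in ?M. (\<lambda>n. k x * \<psi> n x) \<longlonglongrightarrow> \<bar>k x\<bar>"
      by (subst AE_restrict_space_iff) auto
  qed simp
  then have "(LINT x|?M. \<bar>k x\<bar>) = 0"
    by (simp add: zero LIMSEQ_const_iff)
  then have "AE x in ?M. \<bar>k x\<bar> = 0"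
    using k by (subst (asm) integral_nonneg_eq_0_iff_AE) auto
  then show ?thesis
    by simp
qed

text \<open>An antiderivative of \<open>\<psi>\<close> is compactly supported only because \<open>\<psi>\<close> has mean zero.\<close>

lemma mean_zero_imp_deriv_test_function:
  fixes \<psi> :: "real \<Rightarrow> real"
  assumes cont: "continuous_on UNIV \<psi>" and ab: "0 < a" "b < l"
    and supp: "\<And>x. x \<notin> {a..b} \<Longrightarrow> \<psi> x = 0"
    and mean: "integral {0..l} \<psi> = 0"
  obtains \<phi> where "test_function l \<phi>" "deriv \<phi> = \<psi>"
proof -
  define \<phi> where "\<phi> x = integral {0..x} \<psi>" for x
  have int: "\<psi> integrable_on {c..d}" for c d
    using cont by (intro integrable_continuous_real) (auto intro: continuous_on_subset)
  have left: "\<phi> x = 0" if "x < a" for x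
    unfolding \<phi>_def using that supp by (intro integral_unique has_integral_is_0) auto
  have right: "\<phi> x = 0" if "b < x" for x
  proof (cases "0 \<le> x \<and> 0 \<le> l")
    case True
    \<comment> \<open>As \<open>\<psi>\<close> vanishes to the right of \<open>b\<close>, the
      integrals up to \<open>x\<close> and up to \<open>l\<close> both equal the one up to
      \<open>min x l\<close>, and the one up to \<open>l\<close> is zero by assumption.\<close>
    have "\<psi> z = 0" if "min x l \<le> z" for z
      using that \<open>b < x\<close> ab by (intro supp) (auto simp: min_le_iff_disj)
    then have *: "integral {min x l..y} \<psi> = 0" for y
      by (intro integral_unique has_integral_is_0) auto
    have "integral {0..min x l} \<psi> + integral {min x l..y} \<psi> = integral {0..y} \<psi>" if "min x l \<le> y" for y
      using True that by (intro Henstock_Kurzweil_Integration.integral_combine int) auto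
    from this[of x] this[of l] mean show ?thesis
      by (simp add: * \<phi>_def)
  next
    \<comment> \<open>For negative \<open>x\<close> the interval of integration is empty; for
      negative \<open>l\<close> the support of \<open>\<psi>\<close> lies to the left of 0.\<close>
    case False
    then show ?thesis
      unfolding \<phi>_def using that ab supp by (intro integral_unique has_integral_is_0) auto
  qed
  \<comment> \<open>The fundamental theorem gives a derivative within an interval starting at 0,
    which is two-sided only at positive points. Left of the positive number \<open>a\<close> the
    function is locally zero instead.\<close>
  have deriv: "(\<phi> has_vector_derivative \<psi> x) (at x)" for x
  proof (cases "x < a")
    case True
    have "((\<lambda>_. 0) has_vector_derivative \<psi> x) (at x)"
      using supp[of x] True by simp
    then show ?thesis
      by (rule has_vector_derivative_transform_within_open[of _ _ _ "{..<a}"]) (use True left in auto)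
  next
    case False
    have "(\<phi> has_vector_derivative \<psi> x) (at x within {0..x + 1})"
      unfolding \<phi>_def using False ab cont
      by (intro integral_has_vector_derivative) (auto intro: continuous_on_subset)
    moreover have "x \<in> interior {0..x + 1}"
      using False ab by simp
    ultimately show ?thesis
      by (metis at_within_interior)
  qed
  have "{x. \<phi> x \<noteq> 0} \<subseteq> {a..b}"
    using left right by (auto simp: not_less[symmetric])
  then have "closure {x. \<phi> x \<noteq> 0} \<subseteq> {a..b}"
    by (intro closure_minimal) auto
  with ab have "closure {x. \<phi> x \<noteq> 0} \<subseteq> {0<..<l}"
    by fastforce
  then have "test_function l \<phi>"
    unfolding test_function_def C1_differentiable_on_def using deriv cont by auto
  moreover have "deriv \<phi> = \<psi>"
    using deriv by (auto intro!: DERIV_imp_deriv simp: has_real_derivative_iff_has_vector_derivative)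
  ultimately show ?thesis
    by (rule that)
qed

text \<open>Subtracting from \<open>\<psi>\<close> the multiple of a fixed bump
  \<open>\<eta>\<close> with the same integral leaves the derivative of a test function, to which
  \<open>h\<close> is orthogonal. Rearranged, this says that \<open>h - c\<close> is orthogonal to
  every \<open>\<psi>\<close>, where \<open>c\<close> is the average of \<open>h\<close> weighted by
  \<open>\<eta>\<close>.\<close>

lemma du_Bois_Reymond:
  assumes l: "0 < l" and h: "integrable (lebesgue_on {0<..<l}) h" and weak: "weak_deriv l h (\<lambda>_. 0)"
  obtains c where "AE x in lebesgue_on {0<..<l}. h x = c"
proof -
  let ?M = "lebesgue_on {0<..<l}"
  \<comment> \<open>A tent of height \<open>l / 4\<close> centred at \<open>l / 2\<close>, supported
    well inside the interval.\<close>
  define \<eta> where "\<eta> x = max 0 (l / 4 - \<bar>x - l / 2\<bar>)" for x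
  have \<eta>_cont: "continuous_on A \<eta>" for A
    unfolding \<eta>_def by (intro continuous_intros)
  have \<eta>_supp: "\<eta> x = 0" if "x \<notin> {l / 4..3 * l / 4}" for x
    using that unfolding \<eta>_def by auto
  have "integral {0..l} \<eta> \<noteq> 0"
  proof
    assume "integral {0..l} \<eta> = 0"
    then have "(\<eta> has_integral 0) (cbox 0 l)"
      using integrable_integral[OF integrable_continuous_real[OF \<eta>_cont[of "{0..l}"]]] by simp
    then have "\<eta> (l / 2) = 0"
      by (rule has_integral_0_cbox_imp_0[OF \<eta>_cont, rotated]) (use l in \<open>auto simp: \<eta>_def\<close>)
    with l show False
      by (simp add: \<eta>_def)
  qed
  define I where "I = integral {0..l} \<eta>"
  have I: "I \<noteq> 0"
    unfolding I_def by fact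
  define c where "c = (LINT x|?M. h x * \<eta> x) / I"
  have "AE x in ?M. h x - c = 0"
  proof (rule AE_zero_if_orthogonal_to_compactly_supported)
    show int_hc: "integrable ?M (\<lambda>x. h x - c)"
      using h continuous_imp_integrable_Ioo[of 0 l "\<lambda>_. c"] by simp
    fix \<psi> :: "real \<Rightarrow> real" and a b
    assume \<psi>: "continuous_on UNIV \<psi>" and ab: "0 < a" "b < l" and supp: "\<And>x. x \<notin> {a..b} \<Longrightarrow> \<psi> x = 0"
    define J where "J = integral {0..l} \<psi>"
    have \<psi>_cont: "continuous_on A \<psi>" for A
      using \<psi> by (rule continuous_on_subset) simp
    have int: "\<zeta> integrable_on {0..l}" if "continuous_on UNIV \<zeta>" for \<zeta> :: "real \<Rightarrow> real"
      using that by (intro integrable_continuous_real) (auto intro: continuous_on_subset)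
    have "integral {0..l} (\<lambda>x. \<psi> x - J / I * \<eta> x) = 0"
      using I by (subst Henstock_Kurzweil_Integration.integral_diff)
        (auto intro!: int continuous_intros \<psi>_cont \<eta>_cont simp: J_def[symmetric] I_def[symmetric])
    moreover have "continuous_on UNIV (\<lambda>x. \<psi> x - J / I * \<eta> x)"
      by (intro continuous_intros \<psi>_cont \<eta>_cont)
    moreover have "\<psi> x - J / I * \<eta> x = 0" if "x \<notin> {min a (l / 4)..max b (3 * l / 4)}" for x
    proof -
      have "x \<notin> {a..b}" "x \<notin> {l / 4..3 * l / 4}"
        using that by auto
      then show ?thesis
        using supp \<eta>_supp by simp
    qed
    moreover have "0 < min a (l / 4)" "max b (3 * l / 4) < l"
      using ab l by auto
    ultimately obtain \<phi> where "test_function l \<phi>" and \<phi>: "deriv \<phi> = (\<lambda>x. \<psi> x - J / I * \<eta> x)"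
      by (metis (no_types, lifting) mean_zero_imp_deriv_test_function)
    then have "(LINT x|?M. h x * (\<psi> x - J / I * \<eta> x)) = 0"
      using weak unfolding weak_deriv_def by (metis (no_types, lifting) Bochner_Integration.integral_cong integral_zero minus_zero
          mult_zero_left)
    moreover have int_h: "integrable ?M (\<lambda>x. h x * \<zeta> x)"
      if cont: "continuous_on UNIV \<zeta>" and supp: "\<And>x. x \<notin> {a..b} \<Longrightarrow> \<zeta> x = 0"
      for \<zeta> :: "real \<Rightarrow> real" and a b
    proof -
      obtain B where "\<And>x. \<bar>\<zeta> x\<bar> \<le> B"
        using bounded_continuous_on_UNIV_if_support[OF cont supp] by blast
      moreover have "\<zeta> \<in> borel_measurable ?M"
        using cont by (intro continuous_imp_measurable_on_sets_lebesgue) (auto intro: continuous_on_subset)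
      ultimately show ?thesis
        using h by (intro integrable_mult_bounded)
    qed
    have int_h\<psi>: "integrable ?M (\<lambda>x. h x * \<psi> x)" and int_h\<eta>: "integrable ?M (\<lambda>x. h x * \<eta> x)"
      using int_h[OF \<psi> supp] int_h[OF \<eta>_cont \<eta>_supp] by blast+
    have "(LINT x|?M. h x * (\<psi> x - J / I * \<eta> x)) =
        (LINT x|?M. h x * \<psi> x - J / I * (h x * \<eta> x))"
      by (simp add: algebra_simps)
    also have "\<dots> = (LINT x|?M. h x * \<psi> x) - J * c"
      using int_h\<psi> int_h\<eta> by (simp add: c_def)
    also have "J = (LINT x|?M. \<psi> x)"
      unfolding J_def by (rule integral_Ioo_eq_integral[OF \<psi>_cont, symmetric])
    also have "(LINT x|?M. h x * \<psi> x) - (LINT x|?M. \<psi> x) * c = (LINT x|?M. h x * \<psi> x - c * \<psi> x)"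
      using int_h\<psi> continuous_imp_integrable_Ioo[OF \<psi>_cont] by (simp add: mult.commute)
    also have "\<dots> = (LINT x|?M. (h x - c) * \<psi> x)"
      by (simp add: algebra_simps)
    finally show "(LINT x|?M. (h x - c) * \<psi> x) = 0"
      using \<open>(LINT x|?M. h x * (\<psi> x - J / I * \<eta> x)) = 0\<close> by simp
  qed
  then have "AE x in ?M. h x = c"
    by simp
  then show ?thesis
    by (rule that)
qed

section \<open>Weak derivatives compared with classical ones\<close>

lemma test_functionD:
  assumes "test_function l \<phi>"
  shows "(\<phi> has_real_derivative deriv \<phi> x) (at x)" and "continuous_on A (deriv \<phi>)"
    and "continuous_on A \<phi>" and "\<phi> 0 = 0" and "\<phi> l = 0"
proof -
  obtain D where D: "\<And>x. (\<phi> has_real_derivative D x) (at x)" and cont: "continuous_on UNIV D"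
    using assms
    by (auto simp: test_function_def C1_differentiable_on_def has_real_derivative_iff_has_vector_derivative)
  have "deriv \<phi> = D"
    using D by (auto intro: DERIV_imp_deriv)
  with D have der: "(\<phi> has_real_derivative deriv \<phi> x) (at x)" for x
    by simp
  then show "(\<phi> has_real_derivative deriv \<phi> x) (at x)" .
  show "continuous_on A (deriv \<phi>)"
    using cont \<open>deriv \<phi> = D\<close> continuous_on_subset by blast
  show "continuous_on A \<phi>"
    by (rule DERIV_continuous_on[OF has_field_derivative_at_within[OF der]])
  show "\<phi> 0 = 0" "\<phi> l = 0"
    using assms closure_subset[of "{x. \<phi> x \<noteq> 0}"] unfolding test_function_def by force+
qed

text \<open>Integration by parts; the boundary terms drop out because test functions vanish at 0 and
  \<open>l\<close>.\<close>

lemma weak_deriv_classical: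
  assumes l: "0 \<le> l" and p: "\<And>x. (p has_real_derivative p' x) (at x)" and p': "continuous_on UNIV p'"
  shows "weak_deriv l p p'"
  unfolding weak_deriv_def
proof (intro allI impI)
  fix \<phi> assume \<phi>: "test_function l \<phi>"
  note \<phi>_rules = test_functionD[OF \<phi>]
  have [continuous_intros]: "continuous_on A p" "continuous_on A p'" for A
    using DERIV_continuous_on[OF has_field_derivative_at_within[OF p]] p' continuous_on_subset by blast+
  have "((\<lambda>x. p x * \<phi> x) has_real_derivative p x * deriv \<phi> x + p' x * \<phi> x) (at x within S)" for x S
    by (rule has_field_derivative_at_within) (auto intro!: derivative_eq_intros p \<phi>_rules(1))
  then have "((\<lambda>x. p x * deriv \<phi> x + p' x * \<phi> x) has_integral p l * \<phi> l - p 0 * \<phi> 0) {0..l}"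
    using l by (intro fundamental_theorem_of_calculus)
      (auto simp: has_real_derivative_iff_has_vector_derivative[symmetric])
  then have "integral {0..l} (\<lambda>x. p x * deriv \<phi> x + p' x * \<phi> x) = 0"
    by (simp add: \<phi>_rules integral_unique)
  then have "integral {0..l} (\<lambda>x. p x * deriv \<phi> x) = - integral {0..l} (\<lambda>x. p' x * \<phi> x)"
    by (subst (asm) Henstock_Kurzweil_Integration.integral_add)
      (auto intro!: integrable_continuous_real continuous_intros \<phi>_rules)
  then show "(LINT x|lebesgue_on {0<..<l}. p x * deriv \<phi> x) =
      - (LINT x|lebesgue_on {0<..<l}. p' x * \<phi> x)"
    by (subst (1 2) integral_Ioo_eq_integral) (auto intro!: continuous_intros \<phi>_rules)
qed

text \<open>The difference \<open>f - p\<close> has weak derivative \<open>g - p'\<close>, which is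
  zero almost everywhere, so the lemma of du Bois-Reymond applies. This is the tool for integrating
  a weak equation once.\<close>

lemma weak_deriv_determines_up_to_constant:
  assumes l: "0 < l" and f: "f \<in> L2 l" and g: "g \<in> L2 l" and fg: "weak_deriv l f g"
    and p: "\<And>x. (p has_real_derivative p' x) (at x)" and p': "continuous_on UNIV p'"
    and ae: "AE x in lebesgue_on {0<..<l}. g x = p' x"
  obtains c where "AE x in lebesgue_on {0<..<l}. f x = p x + c"
proof -
  let ?M = "lebesgue_on {0<..<l}"
  have [continuous_intros]: "continuous_on A p" "continuous_on A p'" for A
    using DERIV_continuous_on[OF has_field_derivative_at_within[OF p]] p' continuous_on_subset by blast+
  have int_p: "integrable ?M p" and int_p': "integrable ?M p'"
    by (auto intro!: continuous_imp_integrable_Ioo continuous_intros)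
  note int_f = L2_integrable[OF f] and int_g = L2_integrable[OF g]
  have "weak_deriv l (\<lambda>x. f x - p x) (\<lambda>_. 0)"
    unfolding weak_deriv_def
  proof (intro allI impI)
    fix \<phi> assume \<phi>: "test_function l \<phi>"
    have bounded: "\<exists>B. \<forall>x. \<bar>\<zeta> x\<bar> \<le> B" if "continuous_on UNIV \<zeta>" "\<And>x. x \<notin> {0..l} \<Longrightarrow> \<zeta> x = 0"
      for \<zeta> :: "real \<Rightarrow> real"
      using bounded_continuous_on_UNIV_if_support[OF that] by metis
    have outside: "\<phi> x = 0" if "x \<notin> {0<..<l}" for x
      using \<phi> that closure_subset[of "{x. \<phi> x \<noteq> 0}"] unfolding test_function_def by blast
    \<comment> \<open>Outside the interval \<open>\<phi>\<close> is locally zero. Thus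
      \<open>deriv \<phi>\<close> is continuous with bounded support, hence bounded, and its
      products with integrable functions are integrable.\<close>
    have "deriv \<phi> x = 0" if "x \<notin> {0..l}" for x
    proof -
      have "(\<phi> has_real_derivative 0) (at x)"
        by (rule has_field_derivative_transform_within_open[of "\<lambda>_. 0" _ _ "- {0..l}"])
          (use that outside in \<open>auto simp: open_Compl\<close>)
      then show ?thesis
        by (rule DERIV_imp_deriv)
    qed
    then obtain B where B: "\<And>x. \<bar>deriv \<phi> x\<bar> \<le> B"
      using bounded[OF test_functionD(2)[OF \<phi>]] by blast
    obtain C where C: "\<And>x. \<bar>\<phi> x\<bar> \<le> C"
      using bounded[OF test_functionD(3)[OF \<phi>]] outside by fastforce
    have meas: "\<phi> \<in> borel_measurable ?M" "deriv \<phi> \<in> borel_measurable ?M"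
      using test_functionD(2,3)[OF \<phi>] by (auto intro: continuous_imp_measurable_on_sets_lebesgue)
    have int: "integrable ?M (\<lambda>x. k x * \<phi> x)" "integrable ?M (\<lambda>x. k x * deriv \<phi> x)"
      if "integrable ?M k" for k
      using that meas B C by (auto intro: integrable_mult_bounded)
    have "(LINT x|?M. (f x - p x) * deriv \<phi> x) =
        (LINT x|?M. f x * deriv \<phi> x) - (LINT x|?M. p x * deriv \<phi> x)"
      using int[OF int_f] int[OF int_p] by (simp add: left_diff_distrib)
    also have "(LINT x|?M. f x * deriv \<phi> x) = - (LINT x|?M. g x * \<phi> x)"
      using fg \<phi> by (simp add: weak_deriv_def)
    also have "(LINT x|?M. p x * deriv \<phi> x) = - (LINT x|?M. p' x * \<phi> x)"
      using weak_deriv_classical[of l p p'] l p p' \<phi> by (simp add: weak_deriv_def)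
    also have "(LINT x|?M. g x * \<phi> x) = (LINT x|?M. p' x * \<phi> x)"
      using ae int_g int_p' meas by (intro integral_cong_AE) auto
    finally show "(LINT x|?M. (f x - p x) * deriv \<phi> x) = - (LINT x|?M. 0 * \<phi> x)"
      by simp
  qed
  then obtain c where "AE x in ?M. f x - p x = c"
    using du_Bois_Reymond[OF l] int_f int_p by (metis Bochner_Integration.integrable_diff)
  then have "AE x in ?M. f x = p x + c"
    by eventually_elim simp
  then show ?thesis
    by (rule that)
qed

text \<open>The set of agreement is closed and contains almost every point of the open interval,
  hence all of it, and then also its closure.\<close>

lemma continuous_AE_eq_imp_eq:
  fixes f g :: "real \<Rightarrow> real"
  assumes "a < b" and "continuous_on {a..b} f" "continuous_on {a..b} g"
    and "AE x in lebesgue_on {a<..<b}. f x = g x" and "x \<in> {a..b}"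
  shows "f x = g x"
proof -
  define C where "C = {x \<in> {a..b}. f x - g x = 0}"
  have C: "closed C"
    unfolding C_def
    by (rule continuous_closed_preimage_constant[OF continuous_on_diff[OF assms(2,3)] closed_atLeastAtMost])
  have "{a<..<b} \<inter> space lebesgue \<in> sets lebesgue"
    by simp
  then have "AE y in lebesgue. y \<in> {a<..<b} \<longrightarrow> f y = g y"
    using assms(4) by (rule AE_restrict_space_iff[THEN iffD1])
  then have "AE y in lebesgue. y \<in> {a<..<b} \<longrightarrow> y \<in> C"
    by (rule AE_mp) (auto simp: C_def)
  then have "{a<..<b} \<subseteq> C"
    using mem_closed_if_AE_lebesgue_open[OF open_greaterThanLessThan C] by blast
  then have "closure {a<..<b} \<subseteq> C"
    using C by (rule closure_minimal)
  then have "x \<in> C"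
    using assms(1,5) by auto
  then show ?thesis
    by (simp add: C_def)
qed

section \<open>The solution on an edge\<close>

text \<open>The affine interpolant of the end values plus \<open>x * (l - x) / 2\<close>, the
  torsion function of the interval with Dirichlet conditions.\<close>

definition edge_profile :: "real \<Rightarrow> real \<Rightarrow> real \<Rightarrow> real \<Rightarrow> real" where
  "edge_profile l a b x = a + (b - a) / l * x + x * (l - x) / 2"

lemma edge_profile_0 [simp]: "edge_profile l a b 0 = a"
  by (simp add: edge_profile_def)

lemma edge_profile_len [simp]: "l \<noteq> 0 \<Longrightarrow> edge_profile l a b l = b"
  by (simp add: edge_profile_def)

lemma DERIV_edge_profile:
  "(edge_profile l a b has_real_derivative ((b - a) / l + l / 2 - x)) (at x within S)"
proof -
  have "((\<lambda>x. a + c * x + x * (l - x) / 2) has_real_derivative c + l / 2 - x) (at x within S)" for c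
    by (auto intro!: derivative_eq_intros simp: field_simps)
  then show ?thesis
    unfolding edge_profile_def[abs_def] .
qed

lemma continuous_on_edge_profile: "continuous_on S (edge_profile l a b)"
  using DERIV_edge_profile by (rule DERIV_continuous_on)

text \<open>The affine part contributes length times mean end value; \<open>l ^ 3 / 12\<close> is
  the rigidity of the Dirichlet interval.\<close>

lemma integral_edge_profile:
  assumes "0 < l"
  shows "(LINT x|lebesgue_on {0..l}. edge_profile l a b x) = l * (a + b) / 2 + l ^ 3 / 12"
proof -
  have "(LINT x|lebesgue_on {0..l}. edge_profile l a b x) = integral {0..l} (edge_profile l a b)"
    by (intro lebesgue_integral_eq_integral continuous_imp_integrable_real continuous_on_edge_profile) auto
  also have "\<dots> = l * (a + b) / 2 + l ^ 3 / 12"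
  proof (rule integral_unique)
    define P where "P x = a * x + ((b - a) / l + l / 2) * x\<^sup>2 / 2 - x ^ 3 / 6" for x
    have "(P has_real_derivative a + ((b - a) / l + l / 2) * x - x\<^sup>2 / 2) (at x within S)" for x S
      unfolding P_def by (auto intro!: derivative_eq_intros)
    moreover have "edge_profile l a b x = a + ((b - a) / l + l / 2) * x - x\<^sup>2 / 2" for x
      by (simp add: edge_profile_def algebra_simps add_divide_distrib diff_divide_distrib power2_eq_square)
    ultimately have "(edge_profile l a b has_integral P l - P 0) {0..l}"
      using assms by (intro fundamental_theorem_of_calculus)
        (auto simp: has_real_derivative_iff_has_vector_derivative[symmetric])
    moreover have "P l - P 0 = l * (a + b) / 2 + l ^ 3 / 12"
      using assms by (simp add: P_def field_simps power2_eq_square power3_eq_cube)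
    ultimately show "(edge_profile l a b has_integral l * (a + b) / 2 + l ^ 3 / 12) {0..l}"
      by simp
  qed
  finally show ?thesis .
qed

text \<open>Integrating twice gives a quadratic almost everywhere, by continuity everywhere, and the
  end values fix its two constants. Conversely, the profile is smooth and its classical derivatives
  are weak ones.\<close>

lemma weak_second_deriv_minus_one_iff_edge_profile:
  assumes l: "0 < l" and cont: "continuous_on {0..l} u"
  shows "(\<exists>g \<in> L2 l. weak_deriv l u g \<and> weak_deriv l g (\<lambda>_. - 1)) \<longleftrightarrow>
    (\<forall>x\<in>{0..l}. u x = edge_profile l (u 0) (u l) x)"
proof
  assume "\<exists>g \<in> L2 l. weak_deriv l u g \<and> weak_deriv l g (\<lambda>_. - 1)"
  then obtain g where g: "g \<in> L2 l" "weak_deriv l u g" "weak_deriv l g (\<lambda>_. - 1)"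
    by blast
  have m1: "(\<lambda>_. - 1) \<in> L2 l"
    by (intro continuous_mem_L2 continuous_intros)
  obtain b where b: "AE x in lebesgue_on {0<..<l}. g x = - x + b"
    by (rule weak_deriv_determines_up_to_constant[OF l g(1) m1 g(3), of "\<lambda>x. - x"])
      (auto intro!: derivative_eq_intros continuous_intros)
  obtain c where c: "AE x in lebesgue_on {0<..<l}. u x = (b * x - x\<^sup>2 / 2) + c"
    by (rule weak_deriv_determines_up_to_constant[OF l continuous_mem_L2[OF cont] g(1,2) _ _ b,
          of "\<lambda>x. b * x - x\<^sup>2 / 2"])
      (auto intro!: derivative_eq_intros continuous_intros)
  have u: "u x = (b * x - x\<^sup>2 / 2) + c" if "x \<in> {0..l}" for x
    by (rule continuous_AE_eq_imp_eq[OF l cont _ c that]) (auto intro!: continuous_intros)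
  show "\<forall>x\<in>{0..l}. u x = edge_profile l (u 0) (u l) x"
  proof
    fix x assume x: "x \<in> {0..l}"
    have "(u l - u 0) / l = b - l / 2"
      using l by (simp add: u field_simps power2_eq_square)
    then have "edge_profile l (u 0) (u l) x = u 0 + (b - l / 2) * x + x * (l - x) / 2"
      by (simp add: edge_profile_def)
    then show "u x = edge_profile l (u 0) (u l) x"
      using l by (simp add: u[OF x] u[of 0] algebra_simps diff_divide_distrib power2_eq_square)
  qed
next
  assume u: "\<forall>x\<in>{0..l}. u x = edge_profile l (u 0) (u l) x"
  define g where "g x = (u l - u 0) / l + l / 2 - x" for x
  \<comment> \<open>Nothing is known about \<open>u\<close> outside \<open>[0, l]\<close>, so it is
    replaced by the profile only under integrals over the interval.\<close>
  have cong: "(LINT x|lebesgue_on {0<..<l}. u x * \<zeta> x) =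
      (LINT x|lebesgue_on {0<..<l}. edge_profile l (u 0) (u l) x * \<zeta> x)" for \<zeta>
    by (intro Bochner_Integration.integral_cong refl) (subst u[rule_format], simp_all)
  have "weak_deriv l (edge_profile l (u 0) (u l)) g"
    unfolding g_def using l
    by (intro weak_deriv_classical DERIV_edge_profile continuous_intros) auto
  then have "weak_deriv l u g"
    unfolding weak_deriv_def by (simp add: cong)
  moreover have "weak_deriv l g (\<lambda>_. - 1)"
    unfolding g_def using l
    by (intro weak_deriv_classical) (auto intro!: derivative_eq_intros continuous_intros)
  moreover have "g \<in> L2 l"
    unfolding g_def by (intro continuous_mem_L2 continuous_intros)
  ultimately show "\<exists>g \<in> L2 l. weak_deriv l u g \<and> weak_deriv l g (\<lambda>_. - 1)"
    by blast
qed

section \<open>Reduction to a linear system on the vertices\<close>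

text \<open>Gaussian elimination of the variable \<open>c\<close>, whose column has a nonzero pivot in row \<open>r\<close>.\<close>

lemma square_system_solvable:
  fixes A :: "'r \<Rightarrow> 'c \<Rightarrow> 'k :: field"
  assumes "finite C" and "finite R" and "card R = card C"
    and "\<And>h. (\<forall>i\<in>R. (\<Sum>j\<in>C. A i j * h j) = 0) \<Longrightarrow> \<forall>j\<in>C. h j = 0"
  shows "\<exists>f. \<forall>i\<in>R. (\<Sum>j\<in>C. A i j * f j) = d i"
  using assms
proof (induction C arbitrary: R A d rule: finite_induct)
  case empty
  then show ?case by simp
next
  case (insert c C)
  note inj = insert.prems(3)
  \<comment> \<open>If column \<open>c\<close> were zero, the unit vector at \<open>c\<close> would
    be a nonzero kernel element.\<close>
  have "\<exists>r\<in>R. A r c \<noteq> 0"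
  proof (rule ccontr)
    assume "\<not> ?thesis"
    then have "\<forall>i\<in>R. (\<Sum>j\<in>insert c C. A i j * of_bool (j = c)) = 0"
      using insert.hyps by (simp add: sum.neutral)
    from inj[OF this] show False by simp
  qed
  then obtain r where r: "r \<in> R" "A r c \<noteq> 0" by blast
  \<comment> \<open>The Schur complement of the pivot \<open>A r c\<close>.\<close>
  define B where "B i j = A i j - A i c * A r j / A r c" for i j
  \<comment> \<open>Back substitution: the value at \<open>c\<close> is chosen so that row
    \<open>r\<close> has right-hand side \<open>y\<close>.\<close>
  define ext where "ext h y j = (if j = c then (y - (\<Sum>j\<in>C. A r j * h j)) / A r c else h j)" for h y j
  have sum_ext: "(\<Sum>j\<in>insert c C. A i j * ext h y j) = (\<Sum>j\<in>C. B i j * h j) + A i c * y / A r c" for i h y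
  proof -
    have "(\<Sum>j\<in>C. A i j * ext h y j) = (\<Sum>j\<in>C. A i j * h j)"
      using insert.hyps(2) by (intro sum.cong) (auto simp: ext_def)
    moreover have "(\<Sum>j\<in>C. B i j * h j) = (\<Sum>j\<in>C. A i j * h j) - A i c / A r c * (\<Sum>j\<in>C. A r j * h j)"
      by (simp add: B_def sum_distrib_left sum_subtractf algebra_simps)
    ultimately show ?thesis
      using insert.hyps by (simp add: ext_def diff_divide_distrib algebra_simps)
  qed
  have B_r: "B r j = 0" for j
    using r by (simp add: B_def)
  have "\<exists>f. \<forall>i\<in>R - {r}. (\<Sum>j\<in>C. B i j * f j) = d i - A i c * d r / A r c"
  proof (rule insert.IH)
    show "finite (R - {r})" "card (R - {r}) = card C"
      using insert.prems insert.hyps r by auto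
    fix h assume "\<forall>i\<in>R - {r}. (\<Sum>j\<in>C. B i j * h j) = 0"
    then have "(\<Sum>j\<in>insert c C. A i j * ext h 0 j) = 0" if "i \<in> R" for i
      using that by (cases "i = r") (simp_all add: sum_ext B_r)
    then have "\<forall>i\<in>R. (\<Sum>j\<in>insert c C. A i j * ext h 0 j) = 0"
      by blast
    from inj[OF this] show "\<forall>j\<in>C. h j = 0"
      using insert.hyps(2) by (auto simp: ext_def split: if_splits)
  qed
  then obtain f where f: "\<forall>i\<in>R - {r}. (\<Sum>j\<in>C. B i j * f j) = d i - A i c * d r / A r c"
    by blast
  have "(\<Sum>j\<in>insert c C. A i j * ext f (d r) j) = d i" if "i \<in> R" for i
    using f that r by (cases "i = r") (auto simp: sum_ext B_r)
  then show ?case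
    by blast
qed

text \<open>The value 0 off the graph matches the convention in \<open>lap_domain\<close>, so
  uniqueness of solutions can be equality of HOL functions.\<close>

definition vertex_extension :: "('v, 'e) mgraph \<Rightarrow> ('v \<Rightarrow> real) \<Rightarrow> ('v, 'e) mg_point \<Rightarrow> real" where
  "vertex_extension G f p =
     (if p \<in> points G
      then case p of
        Vertex v \<Rightarrow> f v
      | Interior e x \<Rightarrow> edge_profile (len G e) (f (tail G e)) (f (head G e)) x
      else 0)"

lemma vertex_extension_Vertex: "v \<in> verts G \<Longrightarrow> vertex_extension G f (Vertex v) = f v"
  by (simp add: vertex_extension_def points_def)

text \<open>The weighted graph Laplacian as a sum over arcs. A loop contributes nothing, since its
  two indicators cancel.\<close>

definition stiffness :: "('v, 'e) mgraph \<Rightarrow> ('v \<Rightarrow> real) \<Rightarrow> 'v \<Rightarrow> real" where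
  "stiffness G f v = (\<Sum>e\<in>arcs G. (of_bool (tail G e = v) - of_bool (head G e = v)) *
     (f (tail G e) - f (head G e)) / len G e)"

text \<open>A loop at \<open>v\<close> is counted with both of its ends, in agreement with
  \<open>flux\<close>.\<close>

definition load :: "('v, 'e) mgraph \<Rightarrow> 'v \<Rightarrow> real" where
  "load G v = (\<Sum>e\<in>arcs G. (of_bool (tail G e = v) + of_bool (head G e = v)) * len G e / 2)"

definition vertex_op :: "('v, 'e) mgraph \<Rightarrow> ('v \<Rightarrow> real) \<Rightarrow> ('v \<Rightarrow> real) \<Rightarrow> 'v \<Rightarrow> real" where
  "vertex_op G \<alpha> f v = stiffness G f v + \<alpha> v * f v"

lemma vertex_op_add_scaled:
  "vertex_op G \<alpha> (\<lambda>v. f v + c * h v) v = vertex_op G \<alpha> f v + c * vertex_op G \<alpha> h v"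
proof -
  have "stiffness G (\<lambda>v. f v + c * h v) v = stiffness G f v + c * stiffness G h v"
    unfolding stiffness_def sum_distrib_left sum.distrib[symmetric]
    by (intro sum.cong refl) (simp add: add_divide_distrib diff_divide_distrib algebra_simps)
  then show ?thesis
    by (simp add: vertex_op_def algebra_simps)
qed

lemma vertex_op_fun_upd:
  "vertex_op G (\<alpha>(v\<^sub>0 := s)) f v = vertex_op G \<alpha> f v + of_bool (v = v\<^sub>0) * (s - \<alpha> v\<^sub>0) * f v\<^sub>0"
  by (simp add: vertex_op_def algebra_simps)

section \<open>Dirichlet form, symmetry and solvability of the vertex system\<close>

context metric_graph
begin

lemma finite_verts [simp]: "finite (verts G)"
  and finite_arcs [simp]: "finite (arcs G)"
  and tail_in_verts [simp]: "e \<in> arcs G \<Longrightarrow> tail G e \<in> verts G"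
  and head_in_verts [simp]: "e \<in> arcs G \<Longrightarrow> head G e \<in> verts G"
proof -
  \<comment> \<open>Forgetting the lengths changes neither vertices, arcs nor their ends, so the
    digraph facts carry over.\<close>
  interpret T: fin_digraph "pre_digraph.truncate G"
    by (rule fin_digraph)
  show "finite (verts G)" "finite (arcs G)"
    using T.finite_verts T.finite_arcs by (simp_all add: pre_digraph.defs)
  show "tail G e \<in> verts G" "head G e \<in> verts G" if "e \<in> arcs G"
    using T.tail_in_verts[of e] T.head_in_verts[of e] that by (simp_all add: pre_digraph.defs)
qed

lemma vertex_extension_cong:
  "(\<And>v. v \<in> verts G \<Longrightarrow> f v = h v) \<Longrightarrow> vertex_extension G f = vertex_extension G h"
  by (intro ext) (auto simp: vertex_extension_def points_def split: mg_point.split)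

lemma on_edge_vertex_extension:
  assumes "e \<in> arcs G" and "x \<in> {0..len G e}"
  shows "on_edge G (vertex_extension G f) e x =
    edge_profile (len G e) (f (tail G e)) (f (head G e)) x"
  using assms len_pos[OF assms(1)]
  by (auto simp: on_edge_def glue_def vertex_extension_def points_def)

text \<open>Summation by parts. The right-hand side is the discrete Dirichlet form, from which both
  symmetry and positivity are read off.\<close>

lemma sum_verts_stiffness:
  "(\<Sum>v\<in>verts G. h v * stiffness G f v) =
   (\<Sum>e\<in>arcs G. (f (tail G e) - f (head G e)) * (h (tail G e) - h (head G e)) / len G e)"
proof -
  have "(\<Sum>v\<in>verts G. h v * stiffness G f v) = (\<Sum>e\<in>arcs G. \<Sum>v\<in>verts G.
      (of_bool (tail G e = v) * h v - of_bool (head G e = v) * h v) *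
      ((f (tail G e) - f (head G e)) / len G e))"
    unfolding stiffness_def sum_distrib_left
    by (subst sum.swap) (simp add: algebra_simps add_divide_distrib diff_divide_distrib)
  also have "\<dots> = (\<Sum>e\<in>arcs G. (h (tail G e) - h (head G e)) *
      ((f (tail G e) - f (head G e)) / len G e))"
    by (intro sum.cong refl, simp only: sum_distrib_right[symmetric]) (simp add: sum_subtractf)
  finally show ?thesis
    by (simp add: mult.commute)
qed

text \<open>Both sides are the integral over the graph of the edgewise affine interpolant of
  \<open>h\<close>.\<close>

lemma sum_verts_load:
  "(\<Sum>v\<in>verts G. h v * load G v) = (\<Sum>e\<in>arcs G. len G e * (h (tail G e) + h (head G e)) / 2)"
proof -
  have "(\<Sum>v\<in>verts G. h v * load G v) = (\<Sum>e\<in>arcs G. \<Sum>v\<in>verts G.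
      (of_bool (tail G e = v) * h v + of_bool (head G e = v) * h v) * (len G e / 2))"
    unfolding load_def sum_distrib_left
    by (subst sum.swap) (simp add: algebra_simps add_divide_distrib diff_divide_distrib)
  also have "\<dots> = (\<Sum>e\<in>arcs G. (h (tail G e) + h (head G e)) * (len G e / 2))"
    by (intro sum.cong refl, simp only: sum_distrib_right[symmetric]) (simp add: sum.distrib)
  finally show ?thesis
    by (simp add: mult.commute)
qed

lemma vertex_op_symmetric:
  "(\<Sum>v\<in>verts G. h v * vertex_op G \<alpha> f v) = (\<Sum>v\<in>verts G. f v * vertex_op G \<alpha> h v)"
  by (simp add: vertex_op_def distrib_left sum.distrib sum_verts_stiffness mult_ac)

text \<open>The images of the indicator functions are the columns of the matrix; this form makes
  elimination applicable.\<close>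

lemma vertex_op_eq_sum:
  assumes "i \<in> verts G"
  shows "vertex_op G \<alpha> f i = (\<Sum>j\<in>verts G. vertex_op G \<alpha> (\<lambda>v. of_bool (v = j)) i * f j)"
proof -
  have "(\<Sum>j\<in>verts G. stiffness G (\<lambda>v. of_bool (v = j)) i * f j) =
      (\<Sum>e\<in>arcs G. \<Sum>j\<in>verts G. (of_bool (tail G e = i) - of_bool (head G e = i)) / len G e *
        (of_bool (tail G e = j) * f j - of_bool (head G e = j) * f j))"
    unfolding stiffness_def sum_distrib_right
    by (subst sum.swap) (simp add: algebra_simps add_divide_distrib diff_divide_distrib)
  also have "\<dots> = stiffness G f i"
    unfolding stiffness_def
    by (intro sum.cong refl, simp only: sum_distrib_left[symmetric]) (simp add: sum_subtractf)
  moreover have "(\<Sum>j\<in>verts G. \<alpha> i * of_bool (i = j) * f j) = \<alpha> i * f i"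
    using assms by (simp add: mult.assoc sum_distrib_left[symmetric])
  ultimately show ?thesis
    by (simp add: vertex_op_def distrib_right sum.distrib)
qed

lemma vertex_op_surj:
  assumes "\<And>h v. \<lbrakk>\<forall>v\<in>verts G. vertex_op G \<alpha> h v = 0; v \<in> verts G\<rbrakk> \<Longrightarrow> h v = 0"
  obtains f where "\<forall>v\<in>verts G. vertex_op G \<alpha> f v = d v"
proof -
  have "\<exists>f. \<forall>i\<in>verts G. (\<Sum>j\<in>verts G. vertex_op G \<alpha> (\<lambda>v. of_bool (v = j)) i * f j) = d i"
    by (rule square_system_solvable) (use assms in \<open>auto simp: vertex_op_eq_sum[symmetric]\<close>)
  with that show thesis
    by (auto simp: vertex_op_eq_sum[symmetric])
qed

section \<open>The torsion equation as a linear system\<close>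

lemma flux_vertex_extension:
  "flux G (vertex_extension G f) v = stiffness G f v - load G v"
proof -
  \<comment> \<open>Derivatives are taken within the closed edge, where the function coincides with
    the profile; at the end points they are one-sided.\<close>
  have deriv: "vector_derivative (on_edge G (vertex_extension G f) e) (at x within {0..len G e}) =
      (f (head G e) - f (tail G e)) / len G e + len G e / 2 - x"
    if "e \<in> arcs G" "x \<in> {0..len G e}" for e x
  proof (rule vector_derivative_within_closed_interval[OF len_pos[OF that(1)] that(2)])
    show "(on_edge G (vertex_extension G f) e has_vector_derivative
        (f (head G e) - f (tail G e)) / len G e + len G e / 2 - x) (at x within {0..len G e})"
      by (rule has_vector_derivative_transform[OF that(2) _
            DERIV_edge_profile[unfolded has_real_derivative_iff_has_vector_derivative]])
        (simp add: on_edge_vertex_extension that(1))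
  qed
  \<comment> \<open>Pointing into its end, each profile has slope given by the difference quotient
    of the vertex values minus \<open>len G e / 2\<close>; the former sum to
    \<open>stiffness\<close>, the latter to \<open>load\<close>.\<close>
  have "flux G (vertex_extension G f) v =
      (\<Sum>e | e \<in> arcs G \<and> tail G e = v.
        (f (tail G e) - f (head G e)) / len G e - len G e / 2) +
      (\<Sum>e | e \<in> arcs G \<and> head G e = v.
        (f (head G e) - f (tail G e)) / len G e - len G e / 2)"
    unfolding flux_def
    using len_pos by (intro arg_cong2[of _ _ _ _ "(+)"] sum.cong refl)
      (auto simp: deriv less_imp_le diff_divide_distrib)
  also have "\<dots> = (\<Sum>e\<in>arcs G. of_bool (tail G e = v) *
        ((f (tail G e) - f (head G e)) / len G e - len G e / 2)) +
      (\<Sum>e\<in>arcs G. of_bool (head G e = v) *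
        ((f (head G e) - f (tail G e)) / len G e - len G e / 2))"
    by (intro arg_cong2[of _ _ _ _ "(+)"] sum.mono_neutral_cong_left) auto
  also have "\<dots> = stiffness G f v - load G v"
    unfolding stiffness_def load_def sum.distrib[symmetric] sum_subtractf[symmetric]
    by (intro sum.cong refl) (simp add: diff_divide_distrib algebra_simps)
  finally show ?thesis .
qed

text \<open>The equation on the edges and the vanishing off the graph force the form of
  \<open>u\<close>; the vertex conditions then become the linear system.\<close>

lemma neg_laplacian_one_iff:
  "neg_laplacian G \<alpha> u (\<lambda>_. 1) \<longleftrightarrow>
   u = vertex_extension G (u \<circ> Vertex) \<and> (\<forall>v\<in>verts G. vertex_op G \<alpha> (u \<circ> Vertex) v = load G v)"
    (is "?L \<longleftrightarrow> ?u \<and> ?op")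
proof -
  let ?h = "\<lambda>e. on_edge G u e"
  have one: "on_edge G (\<lambda>_. 1) e = (\<lambda>_. 1)" for e
    by (simp add: on_edge_def)
  have L2c: "(\<lambda>_. c) \<in> L2 l" for c l
    by (intro continuous_mem_L2 continuous_intros)
  have ends: "?h e 0 = u (Vertex (tail G e))" "?h e (len G e) = u (Vertex (head G e))"
    if "e \<in> arcs G" for e
    using len_pos[OF that] by (auto simp: on_edge_def glue_def)
  have edge: "(continuous_on {0..len G e} (?h e) \<and>
      (\<exists>g \<in> L2 (len G e). weak_deriv (len G e) (?h e) g \<and> weak_deriv (len G e) g (\<lambda>_. - 1))) \<longleftrightarrow>
      (\<forall>x\<in>{0..len G e}. ?h e x =
        edge_profile (len G e) (u (Vertex (tail G e))) (u (Vertex (head G e))) x)"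
    (is "_ \<longleftrightarrow> ?P e") if "e \<in> arcs G" for e
  proof -
    have "continuous_on {0..len G e} (?h e)" if "?P e"
      using that continuous_on_edge_profile by (subst continuous_on_cong[OF refl]) auto
    then show ?thesis
      using weak_second_deriv_minus_one_iff_edge_profile[OF len_pos[OF that], of "?h e"]
      unfolding ends[OF that] by blast
  qed
  \<comment> \<open>Membership in the Sobolev space follows from the equation: \<open>g\<close> and
    the constant -1 are the required weak derivatives.\<close>
  have sob: "?h e \<in> sobolev 2 (len G e)"
    if "continuous_on {0..len G e} (?h e)"
      "\<exists>g \<in> L2 (len G e). weak_deriv (len G e) (?h e) g \<and> weak_deriv (len G e) g (\<lambda>_. - 1)" for e
    using that L2c continuous_mem_L2[OF that(1)] by (auto simp: numeral_2_eq_2)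
  have "?L \<longleftrightarrow> ((\<forall>p. p \<notin> points G \<longrightarrow> u p = 0) \<and> (\<forall>e\<in>arcs G. ?P e)) \<and>
      (\<forall>v\<in>verts G. flux G u v + \<alpha> v * u (Vertex v) = 0)"
    unfolding neg_laplacian_def lap_domain_def using edge sob by (auto simp: one L2c)
  also have "((\<forall>p. p \<notin> points G \<longrightarrow> u p = 0) \<and> (\<forall>e\<in>arcs G. ?P e)) \<longleftrightarrow> ?u"
  proof
    assume *: "(\<forall>p. p \<notin> points G \<longrightarrow> u p = 0) \<and> (\<forall>e\<in>arcs G. ?P e)"
    have "u (Interior e x) = edge_profile (len G e) (u (Vertex (tail G e))) (u (Vertex (head G e))) x"
      if "e \<in> arcs G" "0 < x" "x < len G e" for e x
    proof -
      have "x \<in> {0..len G e}"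
        using that by simp
      with * that(1) have "?h e x =
          edge_profile (len G e) (u (Vertex (tail G e))) (u (Vertex (head G e))) x"
        by blast
      with that(2,3) show ?thesis
        by (simp add: on_edge_def glue_def)
    qed
    with * show ?u
      by (intro ext) (auto simp: vertex_extension_def points_def split: mg_point.split)
  next
    assume ?u
    then have "?h e x = on_edge G (vertex_extension G (u \<circ> Vertex)) e x" for e x
      by metis
    moreover have "u p = 0" if "p \<notin> points G" for p
      using that by (subst \<open>?u\<close>) (simp add: vertex_extension_def)
    ultimately show "(\<forall>p. p \<notin> points G \<longrightarrow> u p = 0) \<and> (\<forall>e\<in>arcs G. ?P e)"
      by (simp add: on_edge_vertex_extension)
  qed
  also have "?u \<and> (\<forall>v\<in>verts G. flux G u v + \<alpha> v * u (Vertex v) = 0) \<longleftrightarrow> ?u \<and> ?op"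
  proof (rule conj_cong[OF refl])
    assume ?u
    then have "flux G u v = stiffness G (u \<circ> Vertex) v - load G v" for v
      by (metis flux_vertex_extension)
    then show "(\<forall>v\<in>verts G. flux G u v + \<alpha> v * u (Vertex v) = 0) \<longleftrightarrow> ?op"
      by (auto simp: vertex_op_def)
  qed
  finally show ?thesis .
qed

lemma vertex_op_cong:
  "\<lbrakk>\<And>v. v \<in> verts G \<Longrightarrow> f v = h v; v \<in> verts G\<rbrakk> \<Longrightarrow> vertex_op G \<alpha> f v = vertex_op G \<alpha> h v"
  by (simp add: vertex_op_def stiffness_def)

lemma neg_laplacian_vertex_extension_iff:
  "neg_laplacian G \<alpha> (vertex_extension G f) (\<lambda>_. 1) \<longleftrightarrow>
   (\<forall>v\<in>verts G. vertex_op G \<alpha> f v = load G v)"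
proof -
  have "vertex_op G \<alpha> (vertex_extension G f \<circ> Vertex) v = vertex_op G \<alpha> f v" if "v \<in> verts G" for v
    using that by (intro vertex_op_cong) (simp_all add: vertex_extension_Vertex)
  moreover have "vertex_extension G (vertex_extension G f \<circ> Vertex) = vertex_extension G f"
    by (intro vertex_extension_cong) (simp add: vertex_extension_Vertex)
  ultimately show ?thesis
    by (simp add: neg_laplacian_one_iff)
qed

text \<open>Adding a null vector to the vertex values of the solution would give a second
  solution.\<close>

lemma torsion_exists_imp_kernel_trivial:
  assumes ex: "torsion_exists G \<alpha>" and h: "\<forall>v\<in>verts G. vertex_op G \<alpha> h v = 0" and v: "v \<in> verts G"
  shows "h v = 0"
proof -
  obtain u where "neg_laplacian G \<alpha> u (\<lambda>_. 1)"
    using ex by (auto simp: torsion_exists_def)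
  then have f: "\<forall>v\<in>verts G. vertex_op G \<alpha> (u \<circ> Vertex) v = load G v"
    by (simp add: neg_laplacian_one_iff)
  then have "\<forall>v\<in>verts G. vertex_op G \<alpha> (\<lambda>v. (u \<circ> Vertex) v + 1 * h v) v = load G v"
    using h unfolding vertex_op_add_scaled by (simp del: o_apply)
  with f ex have "vertex_extension G (u \<circ> Vertex) = vertex_extension G (\<lambda>v. (u \<circ> Vertex) v + 1 * h v)"
    unfolding torsion_exists_def neg_laplacian_vertex_extension_iff[symmetric] by blast
  from fun_cong[OF this, of "Vertex v"] v show ?thesis
    by (simp add: vertex_extension_Vertex)
qed

text \<open>The vertex values of two solutions differ by a null vector, and vertex values determine
  a solution.\<close>

lemma torsion_eq_vertex_extension:
  assumes ker: "\<And>h v. \<lbrakk>\<forall>v\<in>verts G. vertex_op G \<alpha> h v = 0; v \<in> verts G\<rbrakk> \<Longrightarrow> h v = 0"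
    and f: "\<forall>v\<in>verts G. vertex_op G \<alpha> f v = load G v"
  shows "torsion_exists G \<alpha>" and "torsion G \<alpha> = vertex_extension G f"
proof -
  have sol: "neg_laplacian G \<alpha> (vertex_extension G f) (\<lambda>_. 1)"
    using f by (simp add: neg_laplacian_vertex_extension_iff)
  have uniq: "u = vertex_extension G f" if "neg_laplacian G \<alpha> u (\<lambda>_. 1)" for u
  proof -
    have u: "u = vertex_extension G (u \<circ> Vertex)"
      "\<forall>v\<in>verts G. vertex_op G \<alpha> (u \<circ> Vertex) v = load G v"
      using that by (simp_all add: neg_laplacian_one_iff)
    have "\<forall>v\<in>verts G. vertex_op G \<alpha> (\<lambda>v. (u \<circ> Vertex) v + (- 1) * f v) v = 0"
      using u(2) f unfolding vertex_op_add_scaled by (simp del: o_apply)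
    then have "(u \<circ> Vertex) v = f v" if "v \<in> verts G" for v
      using ker[of "\<lambda>v. (u \<circ> Vertex) v + (- 1) * f v" v] that by simp
    then have "vertex_extension G (u \<circ> Vertex) = vertex_extension G f"
      by (rule vertex_extension_cong)
    with u(1) show ?thesis
      by simp
  qed
  show "torsion_exists G \<alpha>"
    unfolding torsion_exists_def using sol uniq by blast
  show "torsion G \<alpha> = vertex_extension G f"
    unfolding torsion_def using sol uniq by (rule the_equality)
qed

lemma torsion_exists_imp_eq_vertex_extension:
  assumes "torsion_exists G \<alpha>"
  obtains f where "\<forall>v\<in>verts G. vertex_op G \<alpha> f v = load G v" and "torsion G \<alpha> = vertex_extension G f"
proof -
  have "neg_laplacian G \<alpha> (torsion G \<alpha>) (\<lambda>_. 1)"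
    using assms unfolding torsion_exists_def torsion_def by (rule theI')
  then show ?thesis
    using that[of "torsion G \<alpha> \<circ> Vertex"] by (simp add: neg_laplacian_one_iff)
qed

text \<open>The constant is the total rigidity of the edges with Dirichlet conditions at their ends;
  only the first sum depends on \<open>f\<close>.\<close>

lemma mg_integral_vertex_extension:
  "mg_integral G (vertex_extension G f) =
   (\<Sum>v\<in>verts G. f v * load G v) + (\<Sum>e\<in>arcs G. len G e ^ 3 / 12)"
proof -
  have "(LINT x|lebesgue_on {0..len G e}. on_edge G (vertex_extension G f) e x) =
      len G e * (f (tail G e) + f (head G e)) / 2 + len G e ^ 3 / 12" if "e \<in> arcs G" for e
  proof -
    have "(LINT x|lebesgue_on {0..len G e}. on_edge G (vertex_extension G f) e x) =
        (LINT x|lebesgue_on {0..len G e}. edge_profile (len G e) (f (tail G e)) (f (head G e)) x)"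
      by (intro Bochner_Integration.integral_cong) (auto simp: on_edge_vertex_extension that)
    with integral_edge_profile[OF len_pos[OF that]] show ?thesis
      by simp
  qed
  then show ?thesis
    by (simp add: mg_integral_def sum_verts_load sum.distrib)
qed

section \<open>Perturbation of one vertex strength\<close>

text \<open>The Sherman-Morrison formula: the perturbed solution is sought as
  \<open>f + c * w\<close>.\<close>

lemma rigidity_fun_upd:
  assumes ex: "torsion_exists G \<alpha>" and v\<^sub>0: "v\<^sub>0 \<in> verts G"
    and w: "\<forall>v\<in>verts G. vertex_op G \<alpha> w v = of_bool (v = v\<^sub>0)"
    and D: "1 + (s - \<alpha> v\<^sub>0) * w v\<^sub>0 \<noteq> 0"
  shows "torsion_exists G (\<alpha>(v\<^sub>0 := s))"
    and "rigidity G (\<alpha>(v\<^sub>0 := s)) = rigidity G \<alpha> -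
      (s - \<alpha> v\<^sub>0) * (torsion G \<alpha> (Vertex v\<^sub>0))\<^sup>2 / (1 + (s - \<alpha> v\<^sub>0) * w v\<^sub>0)"
proof -
  define t where "t = s - \<alpha> v\<^sub>0"
  have D': "1 + t * w v\<^sub>0 \<noteq> 0"
    using D by (simp add: t_def)
  obtain f where f: "\<forall>v\<in>verts G. vertex_op G \<alpha> f v = load G v"
    and tors: "torsion G \<alpha> = vertex_extension G f"
    by (rule torsion_exists_imp_eq_vertex_extension[OF ex])
  note ker = torsion_exists_imp_kernel_trivial[OF ex]
  have ker_s: "h v = 0" if h: "\<forall>v\<in>verts G. vertex_op G (\<alpha>(v\<^sub>0 := s)) h v = 0" and v: "v \<in> verts G" for h v
  proof -
    \<comment> \<open>The unperturbed operator maps \<open>h\<close> to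
      \<open>- t * h v\<^sub>0\<close> times the indicator of \<open>v\<^sub>0\<close>; the multiple
      of \<open>w\<close> cancels this.\<close>
    have "\<forall>v\<in>verts G. vertex_op G \<alpha> (\<lambda>v. h v + (t * h v\<^sub>0) * w v) v = 0"
      using h w unfolding vertex_op_add_scaled by (simp add: vertex_op_fun_upd t_def mult_ac)
    from ker[OF this] have *: "h v + (t * h v\<^sub>0) * w v = 0" if "v \<in> verts G" for v
      using that by blast
    have "h v\<^sub>0 * (1 + t * w v\<^sub>0) = 0"
      using *[OF v\<^sub>0] by (simp add: algebra_simps)
    with D' *[OF v] show ?thesis
      by simp
  qed
  \<comment> \<open>The solution of \<open>c + t * (f v\<^sub>0 + c * w v\<^sub>0) = 0\<close>, so
    that the residual at \<open>v\<^sub>0\<close> vanishes.\<close>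
  define c where "c = - (t * f v\<^sub>0 / (1 + t * w v\<^sub>0))"
  define g where "g v = f v + c * w v" for v
  have "c + t * g v\<^sub>0 = 0"
    using D' by (simp add: c_def g_def field_simps)
  then have g: "\<forall>v\<in>verts G. vertex_op G (\<alpha>(v\<^sub>0 := s)) g v = load G v"
    using f w unfolding vertex_op_fun_upd unfolding g_def[abs_def] vertex_op_add_scaled
    by (simp add: t_def)
  show "torsion_exists G (\<alpha>(v\<^sub>0 := s))"
    by (rule torsion_eq_vertex_extension(1)[OF _ g]) (erule ker_s, assumption)
  have tors_s: "torsion G (\<alpha>(v\<^sub>0 := s)) = vertex_extension G g"
    by (rule torsion_eq_vertex_extension(2)[OF _ g]) (erule ker_s, assumption)
  \<comment> \<open>Symmetry moves the operator from \<open>f\<close> to \<open>w\<close>, where it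
    yields the indicator of \<open>v\<^sub>0\<close>. Hence the load paired with \<open>w\<close> is
    \<open>f v\<^sub>0\<close>, and the derivative acquires a square.\<close>
  have "(\<Sum>v\<in>verts G. w v * load G v) = (\<Sum>v\<in>verts G. w v * vertex_op G \<alpha> f v)"
    using f by simp
  also have "\<dots> = (\<Sum>v\<in>verts G. f v * vertex_op G \<alpha> w v)"
    by (rule vertex_op_symmetric)
  also have "\<dots> = f v\<^sub>0"
    using w v\<^sub>0 by simp
  finally have "(\<Sum>v\<in>verts G. g v * load G v) = (\<Sum>v\<in>verts G. f v * load G v) + c * f v\<^sub>0"
    by (simp add: g_def distrib_right sum.distrib mult.assoc sum_distrib_left[symmetric])
  then have "rigidity G (\<alpha>(v\<^sub>0 := s)) = rigidity G \<alpha> + c * f v\<^sub>0"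
    by (simp add: rigidity_def tors tors_s mg_integral_vertex_extension)
  then show "rigidity G (\<alpha>(v\<^sub>0 := s)) = rigidity G \<alpha> -
      (s - \<alpha> v\<^sub>0) * (torsion G \<alpha> (Vertex v\<^sub>0))\<^sup>2 / (1 + (s - \<alpha> v\<^sub>0) * w v\<^sub>0)"
    by (simp add: tors vertex_extension_Vertex v\<^sub>0 c_def t_def power2_eq_square mult.assoc)
qed

lemma rank_one_factor_nonzero:
  assumes \<alpha>: "\<forall>v\<in>verts G. 0 \<le> \<alpha> v" and s: "0 < s" and v\<^sub>0: "v\<^sub>0 \<in> verts G"
    and w: "\<forall>v\<in>verts G. vertex_op G \<alpha> w v = of_bool (v = v\<^sub>0)"
  shows "1 + (s - \<alpha> v\<^sub>0) * w v\<^sub>0 \<noteq> 0"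
proof
  assume D: "1 + (s - \<alpha> v\<^sub>0) * w v\<^sub>0 = 0"
  let ?\<beta> = "\<alpha>(v\<^sub>0 := s)"
  \<comment> \<open>At \<open>v\<^sub>0\<close> the new operator takes \<open>w\<close> to exactly
    the factor assumed to vanish.\<close>
  have "vertex_op G ?\<beta> w v = 0" if "v \<in> verts G" for v
    using that w D by (simp add: vertex_op_fun_upd)
  then have "0 = (\<Sum>v\<in>verts G. w v * vertex_op G ?\<beta> w v)"
    by simp
  also have "\<dots> = (\<Sum>e\<in>arcs G. (w (tail G e) - w (head G e)) * (w (tail G e) - w (head G e)) / len G e) +
      (\<Sum>v\<in>verts G. ?\<beta> v * (w v)\<^sup>2)"
    unfolding vertex_op_def distrib_left sum.distrib sum_verts_stiffness
    by (simp add: power2_eq_square mult_ac)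
  also have "\<dots> \<ge> (\<Sum>v\<in>verts G. ?\<beta> v * (w v)\<^sup>2)"
    using len_pos by (simp add: sum_nonneg less_imp_le)
  \<comment> \<open>All summands are nonnegative, so the energy bounds the single term at
    \<open>v\<^sub>0\<close>, whose coefficient \<open>s\<close> is positive.\<close>
  also have "(\<Sum>v\<in>verts G. ?\<beta> v * (w v)\<^sup>2) \<ge> ?\<beta> v\<^sub>0 * (w v\<^sub>0)\<^sup>2"
    by (rule member_le_sum[OF v\<^sub>0]) (use \<alpha> s in auto)
  finally have "s * (w v\<^sub>0)\<^sup>2 \<le> 0"
    by simp
  with s have "w v\<^sub>0 = 0"
    by (simp add: mult_le_0_iff)
  with D show False
    by simp
qed

end

section \<open>Differentiating the rational formula for the rigidity\<close>

lemma DERIV_rank_one_quotient: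
  fixes c q w a :: real
  assumes "1 + (s - a) * w \<noteq> 0"
  shows "((\<lambda>s. c - (s - a) * q / (1 + (s - a) * w)) has_real_derivative
    - q / (1 + (s - a) * w)\<^sup>2) (at s)"
  using assms by (auto intro!: derivative_eq_intros simp: field_simps power2_eq_square)

theorem theorem6p3:
  fixes G :: "('v, 'e) mgraph" and \<alpha> :: "'v \<Rightarrow> real" and v\<^sub>0 :: 'v
  assumes "metric_graph G" and "connected_mg G"
    and "torsion_exists G \<alpha>"
    and "v\<^sub>0 \<in> verts G"
  shows "(\<exists>U. open U \<and> \<alpha> v\<^sub>0 \<in> U \<and>
            (\<forall>s\<in>U. torsion_exists G (\<alpha>(v\<^sub>0 := s))) \<and>
            (\<lambda>s. rigidity G (\<alpha>(v\<^sub>0 := s))) C1_differentiable_on U) \<and>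
         ((\<lambda>s. rigidity G (\<alpha>(v\<^sub>0 := s))) has_real_derivative
            - (torsion G (\<alpha>(v\<^sub>0 := \<alpha> v\<^sub>0)) (Vertex v\<^sub>0))\<^sup>2) (at (\<alpha> v\<^sub>0)) \<and>
         ((\<forall>v\<in>verts G. 0 \<le> \<alpha> v) \<and> 0 < \<alpha> v\<^sub>0 \<longrightarrow>
            (\<forall>s\<in>{0<..}. torsion_exists G (\<alpha>(v\<^sub>0 := s))) \<and>
            (\<lambda>s. rigidity G (\<alpha>(v\<^sub>0 := s))) C1_differentiable_on {0<..})"
proof -
  interpret metric_graph G
    by fact
  obtain w where w: "\<forall>v\<in>verts G. vertex_op G \<alpha> w v = of_bool (v = v\<^sub>0)"
    using vertex_op_surj[of \<alpha> "\<lambda>v. of_bool (v = v\<^sub>0)"] torsion_exists_imp_kernel_trivial[OF assms(3)]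
    by blast
  define D where "D s = 1 + (s - \<alpha> v\<^sub>0) * w v\<^sub>0" for s
  \<comment> \<open>\<open>D\<close> is affine with value 1 at \<open>\<alpha> v\<^sub>0\<close>, so
    \<open>U\<close> is the real line with at most one point removed.\<close>
  define U where "U = {s. D s \<noteq> 0}"
  define q where "q = (torsion G \<alpha> (Vertex v\<^sub>0))\<^sup>2"
  let ?T = "\<lambda>s. rigidity G (\<alpha>(v\<^sub>0 := s))"
  have contD: "continuous_on A D" for A
    unfolding D_def by (intro continuous_intros)
  have U: "open U"
    unfolding U_def using contD by (intro open_Collect_neq) auto
  have ex: "torsion_exists G (\<alpha>(v\<^sub>0 := s))"
    and rig: "?T s = rigidity G \<alpha> - (s - \<alpha> v\<^sub>0) * q / (1 + (s - \<alpha> v\<^sub>0) * w v\<^sub>0)" if "s \<in> U" for s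
    using rigidity_fun_upd[OF assms(3,4) w, of s] that by (simp_all add: U_def D_def q_def)
  \<comment> \<open>The closed formula for the rigidity holds on the open set \<open>U\<close>, so
    its derivative is that of \<open>?T\<close> there.\<close>
  have deriv: "(?T has_real_derivative - q / (D s)\<^sup>2) (at s)" if "s \<in> U" for s
    unfolding D_def
    by (rule has_field_derivative_transform_within_open[OF DERIV_rank_one_quotient U that])
      (use that rig in \<open>auto simp: U_def D_def\<close>)
  have C1: "?T C1_differentiable_on U"
    unfolding C1_differentiable_on_def
  proof (intro exI conjI ballI)
    show "(?T has_vector_derivative - q / (D s)\<^sup>2) (at s)" if "s \<in> U" for s
      using deriv[OF that] by (simp add: has_real_derivative_iff_has_vector_derivative)
    show "continuous_on U (\<lambda>s. - q / (D s)\<^sup>2)"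
      by (intro continuous_intros contD) (auto simp: U_def)
  qed
  have base: "\<alpha> v\<^sub>0 \<in> U" and "D (\<alpha> v\<^sub>0) = 1"
    by (simp_all add: U_def D_def)
  then have "(?T has_real_derivative - (torsion G (\<alpha>(v\<^sub>0 := \<alpha> v\<^sub>0)) (Vertex v\<^sub>0))\<^sup>2) (at (\<alpha> v\<^sub>0))"
    using deriv[OF base] by (simp add: q_def)
  moreover have "(\<forall>s\<in>{0<..}. torsion_exists G (\<alpha>(v\<^sub>0 := s))) \<and> ?T C1_differentiable_on {0<..}"
    if "\<forall>v\<in>verts G. 0 \<le> \<alpha> v"
  proof -
    \<comment> \<open>For nonnegative strengths the only possible zero of \<open>D\<close> is not
      positive, so the same \<open>U\<close> covers the whole half-line.\<close>
    have "{0<..} \<subseteq> U"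
      using rank_one_factor_nonzero[OF that _ assms(4) w] by (auto simp: U_def D_def)
    then show ?thesis
      using ex C1_differentiable_on_subset[OF C1] by blast
  qed
  ultimately show ?thesis
    using U base ex C1 by blast
qed

end
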